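(* Let $n,k \in \mathbb{N}$ with $n \geqslant 13k-15$ (and $n\geqslant 2$). Then $m(n,2,1,k) = n-2k+2$. That is: for every colouring of the edges of $K_n$ with $2$ colours there is a monochromatic $k$-connected subgraph of $K_n$ on at least $n-2k+2$ vertices, and there is a $2$-colouring of $E(K_n)$ in which no monochromatic $k$-connected subgraph has more than $n-2k+2$ vertices.
   Context: A graph on at least $k+1$ vertices is $k$-connected if deleting any set of at most $k-1$ of its vertices leaves a connected graph. An $r$-colouring of $E(K_n)$ is a function $f:E(K_n)\to[r]=\{1,\dots,r\}$; a subgraph $H\subseteq K_n$ is monochromatic if $f$ is constant on $E(H)$. For $n\geqslant 2$ and $r,k\in\mathbb{N}$, $m(n,r,1,k)$ denotes the minimum, over all $r$-colourings $f$ of $E(K_n)$, of the maximum number of vertices of a monochromatic $k$-connected subgraph of $K_n$ (this maximum is taken to be $0$ if no such subgraph exists). *)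

theory Defs
  imports Main "HOL-Library.FuncSet"
begin

text \<open>
  A simple undirected graph is given by its vertex set \<open>V\<close> and its edge set
  \<open>E \<subseteq> pairs V\<close>, an edge being a two-element set of vertices.
\<close>

definition pairs :: "'a set \<Rightarrow> 'a set set" where
  "pairs V = {e. e \<subseteq> V \<and> card e = 2}"

definition connected_graph :: "'a set \<Rightarrow> 'a set set \<Rightarrow> bool" where
  "connected_graph V E \<longleftrightarrow>
     V \<noteq> {} \<and> (\<forall>u\<in>V. \<forall>v\<in>V. (u, v) \<in> {(x, y). {x, y} \<in> E}\<^sup>*)"

text \<open>
  The bound \<open>card S < k\<close> means \<open>card S \<le> k - 1\<close> without truncated subtraction.
  The graph left by deleting \<open>S\<close> keeps exactly the edges that do not meet \<open>S\<close>.
\<close>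

definition k_connected :: "nat \<Rightarrow> 'a set \<Rightarrow> 'a set set \<Rightarrow> bool" where
  "k_connected k V E \<longleftrightarrow>
     card V \<ge> k + 1 \<and>
     (\<forall>S. S \<subseteq> V \<and> card S < k \<longrightarrow> connected_graph (V - S) {e \<in> E. e \<inter> S = {}})"

definition subgraph_of_K :: "nat \<Rightarrow> nat set \<Rightarrow> nat set set \<Rightarrow> bool" where
  "subgraph_of_K n V E \<longleftrightarrow> V \<subseteq> {1..n} \<and> E \<subseteq> pairs V"

text \<open>Colourings are extensional functions, so that there are only finitely many of them.\<close>

definition colourings :: "nat \<Rightarrow> nat \<Rightarrow> (nat set \<Rightarrow> nat) set" where
  "colourings n r = (pairs {1..n} \<rightarrow>\<^sub>E {1..r})"

definition monochromatic :: "(nat set \<Rightarrow> nat) \<Rightarrow> nat set set \<Rightarrow> bool" where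
  "monochromatic f E \<longleftrightarrow> (\<exists>c. \<forall>e\<in>E. f e = c)"

definition mono_k_connected ::
  "nat \<Rightarrow> (nat set \<Rightarrow> nat) \<Rightarrow> nat \<Rightarrow> nat set \<Rightarrow> nat set set \<Rightarrow> bool" where
  "mono_k_connected n f k V E \<longleftrightarrow>
     subgraph_of_K n V E \<and> monochromatic f E \<and> k_connected k V E"

definition max_mono :: "nat \<Rightarrow> (nat set \<Rightarrow> nat) \<Rightarrow> nat \<Rightarrow> nat" where
  "max_mono n f k = Max (insert 0 {card V | V E. mono_k_connected n f k V E})"

text \<open>
  \<open>m1 n r k\<close> is the quantity \<open>m(n, r, 1, k)\<close>; it is meaningful for \<open>r \<ge> 1\<close>, where
  the set of colourings is nonempty.
\<close>

definition m1 :: "nat \<Rightarrow> nat \<Rightarrow> nat \<Rightarrow> nat" where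
  "m1 n r k = Min ((\<lambda>f. max_mono n f k) ` colourings n r)"

end

theory Submission
  imports Defs
begin

text \<open>
  Lower bound: call a set \<open>R\<close> of vertices \<open>C\<close>-sparse if each vertex of \<open>R\<close> has fewer than \<open>k\<close>
  neighbours of colour \<open>C\<close> outside \<open>R\<close>. Take a red-sparse \<open>R\<close> of maximal size below \<open>2k - 1\<close>. If the red
  graph outside \<open>R\<close> is not \<open>k\<close>-connected, fewer than \<open>k\<close> vertices separate it into parts \<open>A\<close> and \<open>B\<close>,
  and all edges between \<open>A\<close> and \<open>B\<close> are blue. If both parts have at least \<open>k\<close> vertices, they span a
  \<open>k\<close>-connected blue graph, which absorbs \<open>R\<close>. Otherwise the smaller part can be added to \<open>R\<close>, which gives a
  red-sparse set with between \<open>2k - 1\<close> and \<open>3k - 3\<close> vertices. If the same happens with the colours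
  exchanged, then the red-sparse set and the blue-sparse set are disjoint, and there are not enough edges
  to fill the complete bipartite graph between them.

  Upper bound: take disjoint sets \<open>X\<^sub>1, X\<^sub>2, X\<^sub>3, X\<^sub>4\<close> of size \<open>k - 1\<close> and colour so that the blue
  neighbourhoods of vertices in \<open>X\<^sub>1\<close> and \<open>X\<^sub>2\<close> are \<open>X\<^sub>4\<close> and \<open>X\<^sub>3\<close>, and the red neighbourhoods of vertices in
  \<open>X\<^sub>3\<close> and \<open>X\<^sub>4\<close> are \<open>X\<^sub>1\<close> and \<open>X\<^sub>2\<close>. A \<open>k\<close>-connected graph has minimum degree at least \<open>k\<close>, so a
  monochromatic one misses \<open>X\<^sub>1 \<union> X\<^sub>2\<close> or \<open>X\<^sub>3 \<union> X\<^sub>4\<close>.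
\<close>

section \<open>Pairs and vertex cuts\<close>

lemma pair_in_pairs_iff: "{u, v} \<in> pairs V \<longleftrightarrow> u \<in> V \<and> v \<in> V \<and> u \<noteq> v"
  by (auto simp: pairs_def card_2_iff doubleton_eq_iff)

lemma pairs_mono: "U \<subseteq> V \<Longrightarrow> pairs U \<subseteq> pairs V"
  by (auto simp: pairs_def)

text \<open>If \<open>u\<close> does not reach \<open>v\<close>, the set of vertices reachable from
  \<open>u\<close> has no edge leaving it and misses \<open>v\<close>.\<close>

lemma not_connected_graph_cut:
  assumes "\<not> connected_graph V E" "V \<noteq> {}"
  obtains A where "A \<subseteq> V" "A \<noteq> {}" "V - A \<noteq> {}" "\<And>a b. a \<in> A \<Longrightarrow> b \<in> V - A \<Longrightarrow> {a, b} \<notin> E"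
proof -
  let ?r = "{(x, y). {x, y} \<in> E}"
  obtain u v where uv: "u \<in> V" "v \<in> V" "(u, v) \<notin> ?r\<^sup>*"
    using assms by (auto simp: connected_graph_def)
  show thesis
  proof (rule that[of "{x \<in> V. (u, x) \<in> ?r\<^sup>*}"])
    fix a b assume a: "a \<in> {x \<in> V. (u, x) \<in> ?r\<^sup>*}" and b: "b \<in> V - {x \<in> V. (u, x) \<in> ?r\<^sup>*}"
    show "{a, b} \<notin> E"
    proof
      assume "{a, b} \<in> E"
      then have "(u, b) \<in> ?r\<^sup>*" using a by (auto intro: rtrancl_into_rtrancl)
      with b show False by auto
    qed
  qed (use uv in auto)
qed

lemma not_k_connected_cut:
  assumes "\<not> k_connected k V E" "card V \<ge> k + 1"
  obtains A S B where "A \<union> S \<union> B = V" "A \<inter> B = {}" "A \<inter> S = {}" "B \<inter> S = {}"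
    "card S < k" "A \<noteq> {}" "B \<noteq> {}" "\<And>a b. a \<in> A \<Longrightarrow> b \<in> B \<Longrightarrow> {a, b} \<notin> E"
proof -
  obtain S where S: "S \<subseteq> V" "card S < k" "\<not> connected_graph (V - S) {e \<in> E. e \<inter> S = {}}"
    using assms by (auto simp: k_connected_def)
  have "finite V" using assms(2) card.infinite by fastforce
  then have "V - S \<noteq> {}" using S assms(2) card_mono[of S V] finite_subset[OF S(1)] by fastforce
  with S(3) obtain A where A: "A \<subseteq> V - S" "A \<noteq> {}" "V - S - A \<noteq> {}"
    "\<And>a b. a \<in> A \<Longrightarrow> b \<in> V - S - A \<Longrightarrow> {a, b} \<notin> {e \<in> E. e \<inter> S = {}}"
    by (rule not_connected_graph_cut) blast
  show thesis
    by (rule that[of A S "V - S - A"]) (use S A in auto)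
qed

section \<open>Constructions and a degree bound for k-connected graphs\<close>

lemma connected_graph_attach:
  assumes "connected_graph W E" "E \<subseteq> E'" "\<And>v. v \<in> U \<Longrightarrow> \<exists>w\<in>W. {v, w} \<in> E'"
  shows "connected_graph (W \<union> U) E'"
proof -
  let ?r = "{(x, y). {x, y} \<in> E'}"
  have sub: "{(x, y). {x, y} \<in> E}\<^sup>* \<subseteq> ?r\<^sup>*"
    using assms(2) by (intro rtrancl_mono) auto
  have W: "(u, v) \<in> ?r\<^sup>*" if "u \<in> W" "v \<in> W" for u v
    using assms(1) sub that by (auto simp: connected_graph_def)
  have hook: "\<exists>w\<in>W. (v, w) \<in> ?r\<^sup>* \<and> (w, v) \<in> ?r\<^sup>*" if v: "v \<in> W \<union> U" for v
  proof (cases "v \<in> W")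
    case False
    then obtain w where "w \<in> W" "{v, w} \<in> E'" using v assms(3) by blast
    then have "(v, w) \<in> ?r" "(w, v) \<in> ?r" by (auto simp: insert_commute)
    with \<open>w \<in> W\<close> show ?thesis by blast
  qed blast
  have "(u, v) \<in> ?r\<^sup>*" if uv: "u \<in> W \<union> U" "v \<in> W \<union> U" for u v
  proof -
    obtain w w' where "w \<in> W" "w' \<in> W" "(u, w) \<in> ?r\<^sup>*" "(w', v) \<in> ?r\<^sup>*"
      using hook[OF uv(1)] hook[OF uv(2)] by blast
    with W show ?thesis by (meson rtrancl_trans)
  qed
  then show ?thesis using assms(1) by (auto simp: connected_graph_def)
qed

text \<open>Fewer than \<open>k\<close> deletions leave \<open>W\<close> connected and cannot remove
  all the neighbours in \<open>W\<close> of a vertex of \<open>U\<close>, so each surviving vertex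
  of \<open>U\<close> still hangs on to \<open>W\<close>.\<close>

lemma k_connected_attach:
  assumes "k_connected k W E" "E \<subseteq> E'" "E \<subseteq> pairs W" "finite U"
    and deg: "\<And>v. v \<in> U \<Longrightarrow> k \<le> card {w \<in> W. {v, w} \<in> E'}"
  shows "k_connected k (W \<union> U) E'"
proof -
  have cW: "card W \<ge> k + 1" using assms(1) by (simp add: k_connected_def)
  then have fW: "finite W" using card.infinite by fastforce
  have "connected_graph (W \<union> U - S) {e \<in> E'. e \<inter> S = {}}" if S: "S \<subseteq> W \<union> U" "card S < k" for S
  proof -
    have fS: "finite S" using S(1) fW assms(4) finite_subset by blast
    have "card (S \<inter> W) < k" using S(2) card_mono[OF fS, of "S \<inter> W"] by auto
    then have "connected_graph (W - S \<inter> W) {e \<in> E. e \<inter> (S \<inter> W) = {}}"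
      using assms(1) by (auto simp: k_connected_def)
    moreover have "W - S \<inter> W = W - S" by auto
    ultimately have conn: "connected_graph (W - S) {e \<in> E. e \<inter> (S \<inter> W) = {}}" by simp
    \<comment> \<open>Edges of \<open>E\<close> lie inside \<open>W\<close>, so one that avoids
      \<open>S \<inter> W\<close> avoids all of \<open>S\<close>.\<close>
    have sub: "{e \<in> E. e \<inter> (S \<inter> W) = {}} \<subseteq> {e \<in> E'. e \<inter> S = {}}"
      using assms(2,3) unfolding pairs_def by blast
    have "\<exists>w\<in>W - S. {v, w} \<in> {e \<in> E'. e \<inter> S = {}}" if v: "v \<in> U - S" for v
    proof -
      have "\<not> {w \<in> W. {v, w} \<in> E'} \<subseteq> S"
        using card_mono[OF fS, of "{w \<in> W. {v, w} \<in> E'}"] deg[of v] v S(2) by auto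
      with v show ?thesis by auto
    qed
    with connected_graph_attach[OF conn sub, of "U - S"] show ?thesis by (simp add: Un_Diff)
  qed
  moreover have "card (W \<union> U) \<ge> k + 1"
    using cW card_mono[of "W \<union> U" W] fW assms(4) by auto
  ultimately show ?thesis by (auto simp: k_connected_def)
qed

text \<open>After fewer than \<open>k\<close> deletions each side keeps a vertex, say
  \<open>a\<close> and \<open>b\<close>. The rest of \<open>B\<close> is attached to
  \<open>a\<close>, and then the rest of \<open>A\<close> to \<open>b\<close>.\<close>

lemma k_connected_complete_bipartite:
  assumes "finite A" "finite B" "A \<inter> B = {}" "1 \<le> k" "k \<le> card A" "k \<le> card B"
    and edge: "\<And>a b. a \<in> A \<Longrightarrow> b \<in> B \<Longrightarrow> {a, b} \<in> E"
  shows "k_connected k (A \<union> B) E"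
proof -
  have "connected_graph (A \<union> B - S) {e \<in> E. e \<inter> S = {}}" if S: "S \<subseteq> A \<union> B" "card S < k" for S
  proof -
    have fS: "finite S" using S(1) assms(1,2) finite_subset by blast
    have "\<not> A \<subseteq> S" "\<not> B \<subseteq> S" using card_mono[OF fS, of A] card_mono[OF fS, of B] S(2) assms(5,6) by auto
    then obtain a b where ab: "a \<in> A - S" "b \<in> B - S" by blast
    let ?E = "{e \<in> E. e \<inter> S = {}}"
    have edge': "{b, a} \<in> E" if "a \<in> A" "b \<in> B" for a b
      using edge[OF that] by (simp add: insert_commute)
    have "connected_graph {a} {}" by (simp add: connected_graph_def)
    then have "connected_graph ({a} \<union> (B - S)) ?E"
      by (rule connected_graph_attach) (use ab edge' in auto)
    then have "connected_graph (({a} \<union> (B - S)) \<union> (A - S)) ?E"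
      by (rule connected_graph_attach) (use ab edge in auto)
    moreover have "{a} \<union> (B - S) \<union> (A - S) = A \<union> B - S" using ab by auto
    ultimately show ?thesis by simp
  qed
  moreover have "card (A \<union> B) \<ge> k + 1"
    using assms(1-6) by (simp add: card_Un_disjoint)
  ultimately show ?thesis by (auto simp: k_connected_def)
qed

text \<open>Deleting a neighbourhood of fewer than \<open>k\<close> vertices would isolate
  \<open>v\<close>, while a further vertex \<open>u\<close> survives because there are at least
  \<open>k + 1\<close> vertices.\<close>

lemma k_connected_min_degree:
  assumes "k_connected k V E" "E \<subseteq> pairs V" "v \<in> V"
  shows "k \<le> card {w. {v, w} \<in> E}"
proof (rule ccontr)
  let ?S = "{w. {v, w} \<in> E}"
  assume "\<not> k \<le> card ?S"
  then have cS: "card ?S < k" by simp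
  have S: "?S \<subseteq> V - {v}"
  proof
    fix w assume "w \<in> ?S"
    then have "{v, w} \<in> pairs V" using assms(2) by blast
    then show "w \<in> V - {v}" unfolding pair_in_pairs_iff by blast
  qed
  have cV: "card V \<ge> k + 1" using assms(1) by (simp add: k_connected_def)
  then have fV: "finite V" using card.infinite by fastforce
  have fS: "finite ?S" using S fV finite_subset by blast
  have "card (insert v ?S) \<le> k" using cS card_insert_le_m1[of k ?S v] by (simp add: card_insert_if fS)
  then have "\<not> V \<subseteq> insert v ?S" using cV card_mono[of "insert v ?S" V] fS by fastforce
  then obtain u where u: "u \<in> V - ?S" "u \<noteq> v" by blast
  have "connected_graph (V - ?S) {e \<in> E. e \<inter> ?S = {}}"
    using assms(1) S cS by (auto simp: k_connected_def)
  moreover have "v \<in> V - ?S" using S assms(3) by blast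
  ultimately have "(v, u) \<in> {(x, y). {x, y} \<in> {e \<in> E. e \<inter> ?S = {}}}\<^sup>*"
    using u(1) unfolding connected_graph_def by blast
  then show False
    by (cases rule: converse_rtranclE) (use u(2) in auto)
qed

section \<open>Lower bound: sparse sets\<close>

text \<open>The half of the argument that concerns one colour. Only the second alternative
  distinguishes \<open>C\<close> from \<open>D\<close>, so the lemma can be applied again with the
  colours exchanged.\<close>

lemma k_connected_or_sparse_set:
  assumes fV: "finite V" and cols: "pairs V \<subseteq> C \<union> D" and k: "1 \<le> k" and n: "3 * k \<le> card V + 1"
  shows "(\<exists>W\<subseteq>V. card V + 2 \<le> card W + 2 * k \<and>
            (k_connected k W (C \<inter> pairs W) \<or> k_connected k W (D \<inter> pairs W))) \<or>
         (\<exists>R\<subseteq>V. 2 * k \<le> card R + 1 \<and> card R + 3 \<le> 3 * k \<and>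
            (\<forall>v\<in>R. card {w \<in> V - R. {v, w} \<in> C} < k))"
proof -
  \<comment> \<open>The cap of \<open>2 * k - 2\<close> on the size is what may be lost when
    \<open>V - R\<close> itself serves as \<open>W\<close>.\<close>
  define P where "P R \<longleftrightarrow> R \<subseteq> V \<and> card R + 2 \<le> 2 * k \<and> (\<forall>v\<in>R. card {w \<in> V - R. {v, w} \<in> C} < k)" for R
  have "P {}" using k by (simp add: P_def)
  moreover have "\<forall>R. P R \<longrightarrow> card R < 2 * k" using k by (auto simp add: P_def)
  ultimately have "\<exists>R. P R \<and> (\<forall>R'. P R' \<longrightarrow> card R' \<le> card R)"
    by (rule ex_has_greatest_nat[of P "{}" card "2 * k"])
  then obtain R where R: "P R" and max: "\<And>R'. P R' \<Longrightarrow> card R' \<le> card R"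
    by blast
  have RV: "R \<subseteq> V" and cR: "card R + 2 \<le> 2 * k"
    and sparse: "\<And>v. v \<in> R \<Longrightarrow> card {w \<in> V - R. {v, w} \<in> C} < k"
    using R by (auto simp: P_def)
  have fR: "finite R" using RV fV finite_subset by blast
  have cVR: "card (V - R) + card R = card V"
    using RV fR fV card_mono[OF fV RV] by (simp add: card_Diff_subset)
  show ?thesis
  proof (cases "k_connected k (V - R) (C \<inter> pairs (V - R))")
    case True
    moreover have "card V + 2 \<le> card (V - R) + 2 * k" using cVR cR by linarith
    ultimately show ?thesis by blast
  next
    case False
    moreover have "card (V - R) \<ge> k + 1" using cVR cR n by linarith
    ultimately obtain A S B where ASB: "A \<union> S \<union> B = V - R" "A \<inter> B = {}" "A \<inter> S = {}" "B \<inter> S = {}"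
      "card S < k" "A \<noteq> {}" "B \<noteq> {}" and cut: "\<And>a b. a \<in> A \<Longrightarrow> b \<in> B \<Longrightarrow> {a, b} \<notin> C \<inter> pairs (V - R)"
      by (rule not_k_connected_cut) blast
    have fin: "finite A" "finite S" "finite B"
      using ASB(1) fV by (metis finite_Diff finite_Un)+
    have noC: "{a, b} \<notin> C" if "a \<in> A" "b \<in> B" for a b
      using cut[OF that] that ASB(1,2) by (auto simp: pair_in_pairs_iff)
    show ?thesis
    proof (cases "k \<le> card A \<and> k \<le> card B")
      case True
      let ?W = "A \<union> B \<union> R"
      have bip: "k_connected k (A \<union> B) (D \<inter> pairs (A \<union> B))"
      proof (rule k_connected_complete_bipartite)
        fix a b assume ab: "a \<in> A" "b \<in> B"
        then have "{a, b} \<in> pairs (A \<union> B)" using ASB(2) by (auto simp: pair_in_pairs_iff)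
        moreover have "{a, b} \<in> pairs V"
          using ab ASB(1,2) by (auto simp: pair_in_pairs_iff)
        ultimately show "{a, b} \<in> D \<inter> pairs (A \<union> B)" using cols noC[OF ab] by blast
      qed (use fin ASB k True in auto)
      \<comment> \<open>A vertex of \<open>R\<close> has fewer than \<open>k\<close> neighbours of
        colour \<open>C\<close> among the at least \<open>2 * k\<close> vertices of
        \<open>A \<union> B\<close>, hence at least \<open>k\<close> of colour \<open>D\<close>.
        Only \<open>S\<close> is lost.\<close>
      have "k_connected k ?W (D \<inter> pairs ?W)"
      proof (rule k_connected_attach[OF bip])
        fix v assume v: "v \<in> R"
        let ?N = "{w \<in> A \<union> B. {v, w} \<in> C}" and ?M = "{w \<in> A \<union> B. {v, w} \<in> D \<inter> pairs ?W}"
        have "card ?N \<le> card {w \<in> V - R. {v, w} \<in> C}"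
          by (rule card_mono) (use fV ASB(1) in auto)
        then have "card ?N < k" using sparse[OF v] by simp
        have "{v, w} \<in> C \<union> D \<and> {v, w} \<in> pairs ?W" if w: "w \<in> A \<union> B" for w
        proof -
          have "w \<in> V - R" using w ASB(1) by blast
          then have "{v, w} \<in> pairs V" "{v, w} \<in> pairs ?W"
            using v w RV by (auto simp: pair_in_pairs_iff)
          then show ?thesis using cols by blast
        qed
        then have "A \<union> B \<subseteq> ?N \<union> ?M" by blast
        then have "card (A \<union> B) \<le> card (?N \<union> ?M)" by (rule card_mono[rotated]) (use fin in auto)
        also have "\<dots> \<le> card ?N + card ?M" by (rule card_Un_le)
        finally have "card A + card B \<le> card ?N + card ?M"
          using fin ASB(2) by (simp add: card_Un_disjoint)
        then show "k \<le> card ?M" using True \<open>card ?N < k\<close> by linarith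
      qed (use fR pairs_mono[of "A \<union> B" ?W] in auto)
      moreover have "?W \<subseteq> V" using ASB(1) RV by blast
      moreover have "card V + 2 \<le> card ?W + 2 * k"
      proof -
        have "V = ?W \<union> S" using ASB(1) RV by blast
        then have "card V \<le> card ?W + card S" using card_Un_le by metis
        then show ?thesis using ASB(5) k by linarith
      qed
      ultimately show ?thesis by blast
    next
      case False
      \<comment> \<open>Stated for \<open>A'\<close> and \<open>B'\<close> because either side of
        the cut may be the small one. Vertices of \<open>A'\<close> have neighbours of colour
        \<open>C\<close> outside \<open>R \<union> A'\<close> only in \<open>S\<close>; the upper
        size bound is \<open>(2 * k - 2) + (k - 1)\<close>.\<close>
      have grow: "\<exists>R'\<subseteq>V. 2 * k \<le> card R' + 1 \<and> card R' + 3 \<le> 3 * k \<and>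
            (\<forall>v\<in>R'. card {w \<in> V - R'. {v, w} \<in> C} < k)"
        if A': "card A' < k" "A' \<noteq> {}" "A' \<union> S \<union> B' = V - R" "A' \<inter> B' = {}" "A' \<inter> S = {}"
          and noC': "\<And>a b. a \<in> A' \<Longrightarrow> b \<in> B' \<Longrightarrow> {a, b} \<notin> C" for A' B'
      proof (intro exI conjI ballI)
        let ?R = "R \<union> A'"
        have fA': "finite A'" using A'(3) fV by (metis finite_Diff finite_Un)
        have cRA: "card ?R = card R + card A'"
          using A'(3) fR fA' by (intro card_Un_disjoint) auto
        show sub: "?R \<subseteq> V" using A'(3) RV by blast
        show "card ?R + 3 \<le> 3 * k" using cRA cR A'(1) by linarith
        show sparse': "card {w \<in> V - ?R. {v, w} \<in> C} < k" if v: "v \<in> ?R" for v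
        proof (cases "v \<in> R")
          case True
          have "card {w \<in> V - ?R. {v, w} \<in> C} \<le> card {w \<in> V - R. {v, w} \<in> C}"
            by (rule card_mono) (use fV in auto)
          with sparse[OF True] show ?thesis by simp
        next
          case False
          then have "{w \<in> V - ?R. {v, w} \<in> C} \<subseteq> S" using v A'(3) noC' by blast
          then show ?thesis using card_mono[OF fin(2)] ASB(5) by (meson le_less_trans)
        qed
        have "card ?R > card R" using cRA A'(2) fA' by (simp add: card_gt_0_iff)
        \<comment> \<open>The enlarged set is sparse, so by maximality it can violate
          \<open>P\<close> only by its size.\<close>
        then have "\<not> P ?R" using max[of ?R] by linarith
        then show "2 * k \<le> card ?R + 1" using sub sparse' by (auto simp: P_def)
      qed
      show ?thesis
      proof (cases "card A < k")
        case True
        with grow[of A B] ASB noC show ?thesis by blast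
      next
        case False
        with \<open>\<not> (k \<le> card A \<and> k \<le> card B)\<close> have "card B < k" by simp
        moreover have "B \<union> S \<union> A = V - R" "B \<inter> A = {}" using ASB(1,2) by auto
        moreover have "{b, a} \<notin> C" if "b \<in> B" "a \<in> A" for a b
          using noC[OF that(2,1)] by (simp add: insert_commute)
        ultimately show ?thesis using grow[of B A] ASB(4,7) by blast
      qed
    qed
  qed
qed

lemma two_colouring_k_connected:
  assumes fV: "finite V" and cols: "pairs V \<subseteq> C \<union> D" and k: "1 \<le> k"
    and n: "3 * k \<le> card V + 1" "8 * k \<le> card V + 7"
  shows "\<exists>W\<subseteq>V. card V + 2 \<le> card W + 2 * k \<and>
           (k_connected k W (C \<inter> pairs W) \<or> k_connected k W (D \<inter> pairs W))"
proof (rule ccontr)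
  assume none: "\<not> ?thesis"
  obtain R where R: "R \<subseteq> V" "2 * k \<le> card R + 1" "card R + 3 \<le> 3 * k"
      "\<And>v. v \<in> R \<Longrightarrow> card {w \<in> V - R. {v, w} \<in> C} < k"
    using k_connected_or_sparse_set[OF fV cols k n(1)] none by blast
  obtain Q where Q: "Q \<subseteq> V" "2 * k \<le> card Q + 1" "card Q + 3 \<le> 3 * k"
      "\<And>v. v \<in> Q \<Longrightarrow> card {w \<in> V - Q. {v, w} \<in> D} < k"
    using k_connected_or_sparse_set[of V D C k] fV cols k n(1) none by (auto simp: Un_commute)
  have fin: "finite R" "finite Q" using R(1) Q(1) fV finite_subset by blast+
  \<comment> \<open>For a common vertex \<open>v\<close>, every vertex lies in \<open>R\<close>, in
    \<open>Q\<close> or in one of two neighbourhoods of size below \<open>k\<close>. This gives at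
    most \<open>2 * (3 * k - 3) + 2 * (k - 1) = 8 * k - 8\<close> vertices, one too few.\<close>
  have disj: "R \<inter> Q = {}"
  proof (rule ccontr)
    assume "R \<inter> Q \<noteq> {}"
    then obtain v where v: "v \<in> R" "v \<in> Q" by blast
    let ?c = "{w \<in> V - R. {v, w} \<in> C}" and ?d = "{w \<in> V - Q. {v, w} \<in> D}"
    have "w \<in> ?c \<union> ?d" if w: "w \<in> V - (R \<union> Q)" for w
    proof -
      have "{v, w} \<in> pairs V" using v w R(1) by (auto simp: pair_in_pairs_iff)
      then show ?thesis using cols w by blast
    qed
    then have "V \<subseteq> R \<union> Q \<union> (?c \<union> ?d)" by blast
    then have "card V \<le> card (R \<union> Q \<union> (?c \<union> ?d))"
      by (rule card_mono[rotated]) (use fin fV in auto)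
    also have "\<dots> \<le> card R + card Q + (card ?c + card ?d)"
      by (meson add_mono card_Un_le order_trans)
    finally show False using R(3) R(4)[OF v(1)] Q(3) Q(4)[OF v(2)] n(2) by linarith
  qed
  \<comment> \<open>Edges between \<open>R\<close> and \<open>Q\<close> are counted from the
    \<open>R\<close> end in colour \<open>C\<close> and from the \<open>Q\<close> end in colour
    \<open>D\<close>; \<open>prod.swap\<close> aligns the two counts.\<close>
  let ?c = "SIGMA r:R. {q \<in> Q. {r, q} \<in> C}" and ?d = "SIGMA q:Q. {r \<in> R. {q, r} \<in> D}"
  have "R \<times> Q \<subseteq> ?c \<union> prod.swap ` ?d"
  proof
    fix p assume "p \<in> R \<times> Q"
    then obtain r q where p: "p = (r, q)" "r \<in> R" "q \<in> Q" by blast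
    then have "{r, q} \<in> pairs V" using disj R(1) Q(1) by (auto simp: pair_in_pairs_iff)
    then have "{r, q} \<in> C \<or> {q, r} \<in> D" using cols by (auto simp: insert_commute)
    then show "p \<in> ?c \<union> prod.swap ` ?d" using p by force
  qed
  then have "card (R \<times> Q) \<le> card (?c \<union> prod.swap ` ?d)"
    by (rule card_mono[rotated]) (use fin in auto)
  also have "\<dots> \<le> card ?c + card ?d"
    using card_Un_le[of ?c "prod.swap ` ?d"] by (simp add: card_image)
  also have "card ?c = (\<Sum>r\<in>R. card {q \<in> Q. {r, q} \<in> C})" using fin by simp
  also have "\<dots> \<le> card R * (k - 1)"
  proof (rule sum_bounded_above[where 'a = nat, simplified])
    fix r assume r: "r \<in> R"
    have "card {q \<in> Q. {r, q} \<in> C} \<le> card {w \<in> V - R. {r, w} \<in> C}"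
      by (rule card_mono) (use fV Q(1) disj in auto)
    then show "card {q \<in> Q. {r, q} \<in> C} \<le> k - 1" using R(4)[OF r] by linarith
  qed
  also have "card ?d = (\<Sum>q\<in>Q. card {r \<in> R. {q, r} \<in> D})" using fin by simp
  also have "\<dots> \<le> card Q * (k - 1)"
  proof (rule sum_bounded_above[where 'a = nat, simplified])
    fix q assume q: "q \<in> Q"
    have "card {r \<in> R. {q, r} \<in> D} \<le> card {w \<in> V - Q. {q, w} \<in> D}"
      by (rule card_mono) (use fV R(1) disj in auto)
    then show "card {r \<in> R. {q, r} \<in> D} \<le> k - 1" using Q(4)[OF q] by linarith
  qed
  finally have "card R * card Q \<le> card R * (k - 1) + card Q * (k - 1)"
    by (simp add: card_cartesian_product)
  \<comment> \<open>Adding the two products below bounds \<open>2 * card R * card Q\<close> from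
    below by \<open>(2 * (k - 1) + 1) * (card R + card Q)\<close>, which exceeds twice the upper
    bound just obtained.\<close>
  moreover have "2 * (k - 1) + 1 \<le> card R" "2 * (k - 1) + 1 \<le> card Q"
    using R(2) Q(2) k by linarith+
  then have "card R * (2 * (k - 1) + 1) \<le> card R * card Q" "card Q * (2 * (k - 1) + 1) \<le> card Q * card R"
    by (simp_all only: mult_le_mono2)
  moreover have "card R > 0" using R(2) k by linarith
  ultimately show False by (simp add: algebra_simps)
qed

section \<open>From graphs to colourings\<close>

lemma finite_colourings: "finite (colourings n r)"
proof -
  have "pairs {1..n} \<subseteq> Pow {1..n}" by (auto simp: pairs_def)
  then have "finite (pairs {1..n})" using finite_subset by blast
  then show ?thesis by (simp add: colourings_def finite_PiE)
qed

lemma card_mono_k_connected_le: "mono_k_connected n f k V E \<Longrightarrow> card V \<le> n"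
  using card_mono[of "{1..n}" V] by (simp add: mono_k_connected_def subgraph_of_K_def)

text \<open>Subgraph orders are at most \<open>n\<close>, so \<open>Max\<close> ranges over a finite
  set, and the default value 0 respects every bound \<open>b\<close>.\<close>

lemma max_mono_le_iff:
  "max_mono n f k \<le> b \<longleftrightarrow> (\<forall>V E. mono_k_connected n f k V E \<longrightarrow> card V \<le> b)"
proof -
  have "finite {card V | V E. mono_k_connected n f k V E}"
    by (rule finite_subset[of _ "{..n}"]) (auto dest: card_mono_k_connected_le)
  then show ?thesis by (auto simp: max_mono_def)
qed

lemma colouring_lower_bound:
  assumes "f \<in> colourings n 2" "1 \<le> k" "3 * k \<le> n + 1" "8 * k \<le> n + 7"
  shows "\<exists>V E. mono_k_connected n f k V E \<and> n + 2 \<le> card V + 2 * k"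
proof -
  let ?C = "{e. f e = 1}" and ?D = "{e. f e = 2}"
  have "pairs {1..n} \<subseteq> ?C \<union> ?D"
  proof
    fix e assume "e \<in> pairs {1..n}"
    then have "f e \<in> {1..2}" using assms(1) by (auto simp: colourings_def PiE_def Pi_def)
    then show "e \<in> ?C \<union> ?D" by auto
  qed
  from two_colouring_k_connected[OF _ this assms(2)] assms(3,4)
  obtain W where W: "W \<subseteq> {1..n}" "n + 2 \<le> card W + 2 * k"
    "k_connected k W (?C \<inter> pairs W) \<or> k_connected k W (?D \<inter> pairs W)" by auto
  moreover have "mono_k_connected n f k W ({e. f e = c} \<inter> pairs W)"
    if "k_connected k W ({e. f e = c} \<inter> pairs W)" for c
    using W(1) that by (auto simp: mono_k_connected_def subgraph_of_K_def monochromatic_def)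
  ultimately show ?thesis by blast
qed

section \<open>Upper bound: the extremal colouring\<close>

lemma colouring_upper_bound:
  assumes "1 \<le> k" "4 * k \<le> n + 4"
  shows "\<exists>f\<in>colourings n 2. \<forall>V E. mono_k_connected n f k V E \<longrightarrow> card V + 2 * k \<le> n + 2"
proof -
  define m where "m = k - 1"
  have m: "4 * m \<le> n" "m < k" and km: "k = m + 1" using assms by (auto simp: m_def)
  define X1 X2 X3 X4 where X: "X1 = {0<..m}" "X2 = {m<..2*m}" "X3 = {2*m<..3*m}" "X4 = {3*m<..4*m}"
  have cX: "card X1 = m" "card X2 = m" "card X3 = m" "card X4 = m" by (auto simp: X)
  have fX: "finite X1" "finite X2" "finite X3" "finite X4" by (auto simp: X)
  have disj: "X1 \<inter> X2 = {}" "X1 \<inter> X3 = {}" "X1 \<inter> X4 = {}" "X2 \<inter> X3 = {}" "X2 \<inter> X4 = {}" "X3 \<inter> X4 = {}"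
    by (auto simp: X)
  have XV: "X1 \<subseteq> {1..n}" "X2 \<subseteq> {1..n}" "X3 \<subseteq> {1..n}" "X4 \<subseteq> {1..n}"
    using m by (auto simp: X)
  \<comment> \<open>Red edges are those that meet \<open>X1 \<union> X2\<close>, except the edges
    joining \<open>X1\<close> to \<open>X4\<close> or \<open>X2\<close> to
    \<open>X3\<close>.\<close>
  define red where "red e \<longleftrightarrow> e \<inter> (X1 \<union> X2) \<noteq> {} \<and> (e \<inter> X1 = {} \<or> e \<inter> X4 = {}) \<and> (e \<inter> X2 = {} \<or> e \<inter> X3 = {})" for e
  have red_iff: "red {v, w} \<longleftrightarrow> (v \<in> X1 \<or> v \<in> X2 \<or> w \<in> X1 \<or> w \<in> X2) \<and>
      (v \<notin> X1 \<and> w \<notin> X1 \<or> v \<notin> X4 \<and> w \<notin> X4) \<and> (v \<notin> X2 \<and> w \<notin> X2 \<or> v \<notin> X3 \<and> w \<notin> X3)" for v w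
    by (simp add: red_def)
  have red_nbr: "v \<in> X3 \<Longrightarrow> w \<in> X1" "v \<in> X4 \<Longrightarrow> w \<in> X2" if "red {v, w}" for v w
    using that[unfolded red_iff] disj by blast+
  have blue_nbr: "v \<in> X1 \<Longrightarrow> w \<in> X4" "v \<in> X2 \<Longrightarrow> w \<in> X3" if "\<not> red {v, w}" for v w
    using that[unfolded red_iff] disj by blast+
  define f where "f = restrict (\<lambda>e. if red e then 1 else 2 :: nat) (pairs {1..n})"
  \<comment> \<open>Vertices of \<open>Y \<union> Z\<close> have degree at most \<open>k - 1\<close>
    in \<open>E\<close>, too small for a k-connected graph, so \<open>V\<close> misses all
    \<open>2 * (k - 1)\<close> of them.\<close>
  have miss: "card V + 2 * k \<le> n + 2"
    if VE: "k_connected k V E" "E \<subseteq> pairs V" "V \<subseteq> {1..n}"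
      and YZ: "Y \<union> Z \<subseteq> {1..n}" "Y \<inter> Z = {}" "card Y = m" "card Z = m"
      and nbrs: "\<And>v. v \<in> Y \<union> Z \<Longrightarrow> \<exists>N. finite N \<and> card N = m \<and> {w. {v, w} \<in> E} \<subseteq> N" for V E Y Z
  proof -
    have "v \<notin> V" if v: "v \<in> Y \<union> Z" for v
    proof
      assume "v \<in> V"
      then have "k \<le> card {w. {v, w} \<in> E}"
        by (rule k_connected_min_degree[OF VE(1,2)])
      moreover obtain N where "finite N" "card N = m" "{w. {v, w} \<in> E} \<subseteq> N"
        using nbrs[OF v] by blast
      ultimately show False using m(2) card_mono[of N "{w. {v, w} \<in> E}"] by linarith
    qed
    then have "V \<inter> (Y \<union> Z) = {}" by blast
    moreover have fin: "finite V" "finite Y" "finite Z"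
      using VE(3) YZ(1) finite_subset[of _ "{1..n}"] by auto
    ultimately have "card (V \<union> (Y \<union> Z)) = card V + 2 * m"
      using YZ by (simp add: card_Un_disjoint)
    moreover have "card (V \<union> (Y \<union> Z)) \<le> card {1..n}"
      by (rule card_mono) (use VE(3) YZ(1) in auto)
    ultimately show ?thesis using km by simp
  qed
  show ?thesis
  proof (intro bexI allI impI)
    show "f \<in> colourings n 2" by (auto simp: f_def colourings_def)
    fix V E assume "mono_k_connected n f k V E"
    then have V: "V \<subseteq> {1..n}" "E \<subseteq> pairs V" "k_connected k V E" and "monochromatic f E"
      by (auto simp: mono_k_connected_def subgraph_of_K_def)
    then obtain c where c: "\<And>e. e \<in> E \<Longrightarrow> f e = c" by (auto simp: monochromatic_def)
    have fE: "f e = (if red e then 1 else 2)" if "e \<in> E" for e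
      using that V(2) pairs_mono[OF V(1)] by (auto simp: f_def)
    show "card V + 2 * k \<le> n + 2"
    \<comment> \<open>If \<open>E\<close> is empty, \<open>c\<close> can be any number, so the
      second case is \<open>c \<noteq> 1\<close> and covers more than the colour 2.\<close>
    proof (cases "c = 1")
      case True
      then have E: "red e" if "e \<in> E" for e using c[OF that] fE[OF that] True by (cases "red e") simp_all
      show ?thesis
      proof (rule miss[OF V(3,2,1), of X3 X4])
        fix v assume "v \<in> X3 \<union> X4"
        then have "{w. {v, w} \<in> E} \<subseteq> X1 \<or> {w. {v, w} \<in> E} \<subseteq> X2"
          using red_nbr E by blast
        then show "\<exists>N. finite N \<and> card N = m \<and> {w. {v, w} \<in> E} \<subseteq> N" using fX cX by blast
      qed (use XV disj cX in auto)
    next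
      case False
      then have E: "\<not> red e" if "e \<in> E" for e using c[OF that] fE[OF that] False by (cases "red e") simp_all
      show ?thesis
      proof (rule miss[OF V(3,2,1), of X1 X2])
        fix v assume "v \<in> X1 \<union> X2"
        then have "{w. {v, w} \<in> E} \<subseteq> X4 \<or> {w. {v, w} \<in> E} \<subseteq> X3"
          using blue_nbr E by blast
        then show "\<exists>N. finite N \<and> card N = m \<and> {w. {v, w} \<in> E} \<subseteq> N" using fX cX by blast
      qed (use XV disj cX in auto)
    qed
  qed
qed

section \<open>The exact value\<close>

theorem theorem1p1:
  fixes n k :: nat
  assumes "k \<ge> 1" and "n \<ge> 2" and "int n \<ge> 13 * int k - 15"
  shows "int (m1 n 2 k) = int n - 2 * int k + 2
    \<and> (\<forall>f\<in>colourings n 2. \<exists>V E. mono_k_connected n f k V E \<and> int (card V) \<ge> int n - 2 * int k + 2)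
    \<and> (\<exists>f\<in>colourings n 2. \<forall>V E. mono_k_connected n f k V E \<longrightarrow> int (card V) \<le> int n - 2 * int k + 2)"
proof -
  \<comment> \<open>For \<open>k = 1\<close> these bounds come from \<open>n \<ge> 2\<close>, for
    larger \<open>k\<close> from \<open>13 * k - 15\<close>.\<close>
  have n: "3 * k \<le> n + 1" "8 * k \<le> n + 7" "4 * k \<le> n + 4" using assms by (cases "k = 1"; linarith)+
  have lower: "\<exists>V E. mono_k_connected n f k V E \<and> n + 2 \<le> card V + 2 * k" if "f \<in> colourings n 2" for f
    by (rule colouring_lower_bound[OF that assms(1) n(1,2)])
  obtain f where f: "f \<in> colourings n 2"
    and upper: "\<And>V E. mono_k_connected n f k V E \<Longrightarrow> card V + 2 * k \<le> n + 2"
    using colouring_upper_bound[OF assms(1) n(3)] by blast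
  \<comment> \<open>The subtraction does not truncate: \<open>4 * k \<le> n + 4\<close> gives
    \<open>2 * k \<le> n + 2\<close>.\<close>
  let ?b = "n + 2 - 2 * k"
  have "m1 n 2 k = ?b"
    unfolding m1_def
  proof (rule Min_eqI)
    show "finite ((\<lambda>f. max_mono n f k) ` colourings n 2)" by (simp add: finite_colourings)
    have ge: "?b \<le> max_mono n g k" if g: "g \<in> colourings n 2" for g
    proof -
      obtain V E where VE: "mono_k_connected n g k V E" "n + 2 \<le> card V + 2 * k" using lower[OF g] by blast
      moreover have "card V \<le> max_mono n g k" using VE(1) max_mono_le_iff[of n g k "max_mono n g k"] by blast
      ultimately show ?thesis by linarith
    qed
    then show "?b \<le> y" if "y \<in> (\<lambda>f. max_mono n f k) ` colourings n 2" for y using that by blast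
    have "max_mono n f k \<le> ?b"
      unfolding max_mono_le_iff using upper by fastforce
    then have "?b = max_mono n f k" using ge[OF f] by simp
    then show "?b \<in> (\<lambda>f. max_mono n f k) ` colourings n 2" using f by blast
  qed
  then have "int (m1 n 2 k) = int n - 2 * int k + 2" using n by simp
  moreover have "\<exists>V E. mono_k_connected n g k V E \<and> int (card V) \<ge> int n - 2 * int k + 2"
    if g: "g \<in> colourings n 2" for g
  proof -
    obtain V E where "mono_k_connected n g k V E" "n + 2 \<le> card V + 2 * k" using lower[OF g] by blast
    moreover from this(2) have "int (card V) \<ge> int n - 2 * int k + 2" by linarith
    ultimately show ?thesis by blast
  qed
  moreover have "int (card V) \<le> int n - 2 * int k + 2" if "mono_k_connected n f k V E" for V E
    using upper[OF that] by linarith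
  ultimately show ?thesis using f by blast
qed

end
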